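(* Let $m\ge 3$ and let $P$ be a finite pattern in the plane with at most $m-1$ collinear points and $|P|=k\geq 3$. Then there is a constant $c=c(P)>0$ such that, for all $n$ large enough, \[ S_{P}(n,m)\geq c\,n^{\log(k^{2}+k)/\log(k^{2}-k+1)}. \]
   Context: Identify the plane with $\mathbb{C}$. Sets $A,B$ are similar if $B=zA+w$ for some $z,w\in\mathbb{C}$, $z\neq0$. $S_P(Q)$ is the number of subsets of $Q$ similar to $P$. For $m\ge3$, $S_P(n,m)$ is the maximum of $S_P(Q)$ over all $n$-point sets $Q\subseteq\mathbb{C}$ with no $m$ collinear points. *)

theory Defs
  imports "HOL-Analysis.Analysis"
begin

definition similar :: "complex set \<Rightarrow> complex set \<Rightarrow> bool" where
  "similar A B \<longleftrightarrow> (\<exists>z w. z \<noteq> 0 \<and> B = (\<lambda>x. z * x + w) ` A)"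

definition no_collinear :: "nat \<Rightarrow> complex set \<Rightarrow> bool" where
  "no_collinear m Q \<longleftrightarrow> \<not> (\<exists>T \<subseteq> Q. card T = m \<and> collinear T)"

definition similar_copies :: "complex set \<Rightarrow> complex set \<Rightarrow> nat" where
  "similar_copies P Q = card {A. A \<subseteq> Q \<and> similar P A}"

definition max_similar_copies :: "complex set \<Rightarrow> nat \<Rightarrow> nat \<Rightarrow> nat" where
  "max_similar_copies P n m =
     Max {similar_copies P Q | Q. finite Q \<and> card Q = n \<and> no_collinear m Q}"

text \<open>For \<open>m \<ge> 3\<close> the maximum is taken over a finite nonempty set, hence is attained.\<close>

lemma finite_similar_copies_values:
  "finite {similar_copies P Q | Q. finite Q \<and> card Q = n \<and> no_collinear m Q}"
proof (rule finite_subset)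
  show "{similar_copies P Q | Q. finite Q \<and> card Q = n \<and> no_collinear m Q} \<subseteq> {..2 ^ n}"
  proof clarsimp
    fix Q :: "complex set" assume Q: "finite Q" and "n = card Q"
    have "card {A. A \<subseteq> Q \<and> similar P A} \<le> card (Pow Q)"
      by (rule card_mono) (use Q in auto)
    then show "similar_copies P Q \<le> 2 ^ card Q"
      by (simp add: similar_copies_def card_Pow Q)
  qed
qed simp

lemma ex_no_collinear:
  assumes "m \<ge> 3"
  shows "\<exists>Q. finite Q \<and> card Q = n \<and> no_collinear m Q"
proof -
  define f where "f = (\<lambda>i::nat. Complex (real i) ((real i)\<^sup>2))"
  have "inj f" by (auto simp: f_def inj_on_def)
  have "no_collinear m (f ` {..<n})"
    unfolding no_collinear_def
  proof clarify
    fix T assume T: "T \<subseteq> f ` {..<n}" "m = card T" "collinear T"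
    obtain S where "S \<subseteq> T" "card S = 3"
      using assms T(2) by (metis obtain_subset_with_card_n)
    then obtain a b c where abc: "a \<in> T" "b \<in> T" "c \<in> T" "a \<noteq> b" "a \<noteq> c" "b \<noteq> c"
      by (auto simp: card_3_iff)
    then obtain i j k where ijk: "a = f i" "b = f j" "c = f k" using T(1) by blast
    then have ne: "i \<noteq> j" "i \<noteq> k" "j \<noteq> k" using abc by auto
    obtain u where "\<forall>x\<in>T. \<forall>y\<in>T. \<exists>s. x - y = s *\<^sub>R u" using T(3) unfolding collinear_def by blast
    then obtain s t where "f j - f i = s *\<^sub>R u" "f k - f i = t *\<^sub>R u"
      using abc ijk by metis
    then have "Re (f j - f i) * Im (f k - f i) = Re (f k - f i) * Im (f j - f i)" by simp
    then have "(real j - real i) * ((real k)\<^sup>2 - (real i)\<^sup>2) =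
        (real k - real i) * ((real j)\<^sup>2 - (real i)\<^sup>2)"
      by (simp add: f_def)
    then have "(real j - real i) * (real k - real i) * (real k - real j) = 0"
      unfolding power2_eq_square by algebra
    then show False using ne by simp
  qed
  moreover have "card (f ` {..<n}) = n"
    using \<open>inj f\<close> by (simp add: card_image inj_on_subset)
  ultimately show ?thesis by blast
qed

end

theory Submission
  imports Defs
begin

text \<open>
  Instead of similar copies we count all complex affine maps \<open>p \<mapsto> z p + w\<close>, the constant ones
  included, that send \<open>P\<close> into \<open>A\<close>. This count is multiplicative under \<open>A \<times> B\<close>, and a projection
  \<open>(a, b) \<mapsto> a + v b\<close> with generic \<open>v\<close> carries a finite subset of \<open>\<complex>\<^sup>2\<close> into the plane
  injectively and without creating new collinearities. Projecting the set
  \<open>{((x - p) y, x - p) | x, y \<in> P}\<close>, where \<open>p \<in> P\<close>, gives \<open>k\<^sup>2 - k + 1\<close> points admitting at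
  least \<open>k\<^sup>2 + k\<close> such maps: the constants, the \<open>k\<close> maps with \<open>y\<close> fixed, and the \<open>k - 1\<close> maps with
  \<open>x \<noteq> p\<close> fixed. Powers of this set give the exponent, and adding points in general position
  yields every cardinality.
\<close>

section \<open>Generic projections\<close>

definition proj :: "complex \<Rightarrow> complex \<times> complex \<Rightarrow> complex" where
  "proj v x = fst x + v * snd x"

lemma linear_proj: "linear (proj v)"
  by (rule linearI) (simp_all add: proj_def distrib_left scaleR_right_distrib)

lemma collinear_linear_image:
  assumes "linear f" and "collinear T"
  shows "collinear (f ` T)"
proof -
  obtain u where u: "\<forall>x\<in>T. \<forall>y\<in>T. \<exists>c. x - y = c *\<^sub>R u"
    using assms(2) unfolding collinear_def by blast
  have "\<exists>c. f x - f y = c *\<^sub>R f u" if xy: "x \<in> T" "y \<in> T" for x y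
  proof -
    obtain c where "x - y = c *\<^sub>R u" using u xy by blast
    then have "f x - f y = c *\<^sub>R f u"
      by (simp only: linear_diff[OF assms(1), symmetric] linear_scale[OF assms(1)])
    then show ?thesis ..
  qed
  then show ?thesis
    unfolding collinear_def by (intro exI[of _ "f u"] ballI) (elim imageE, simp)
qed

text \<open>All differences in \<open>T\<close> are real multiples of one direction
  \<open>u\<close>, and \<open>f\<close> maps them to the same multiples of \<open>f u\<close>. The
  two cases are \<open>f u\<close> nonzero and \<open>f u\<close> zero. Applied to the coordinates
  of C^2, this controls every collinear set there.\<close>

lemma linear_inj_or_constant_on_collinear:
  assumes "linear f" and "collinear T"
  shows "inj_on f T \<or> (\<exists>c. \<forall>x\<in>T. f x = c)"
proof -
  obtain u where u: "\<forall>x\<in>T. \<forall>y\<in>T. \<exists>c. x - y = c *\<^sub>R u"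
    using assms(2) unfolding collinear_def by blast
  have d: "\<exists>c. x - y = c *\<^sub>R u \<and> f x - f y = c *\<^sub>R f u" if xy: "x \<in> T" "y \<in> T" for x y
  proof -
    obtain c where c: "x - y = c *\<^sub>R u" using u xy by blast
    then have "f x - f y = c *\<^sub>R f u"
      by (simp only: linear_diff[OF assms(1), symmetric] linear_scale[OF assms(1)])
    with c show ?thesis by blast
  qed
  show ?thesis
  proof (cases "f u = 0")
    case True
    have "f x = f y" if "x \<in> T" "y \<in> T" for x y using d[OF that] True by auto
    then show ?thesis by blast
  next
    case False
    have "inj_on f T"
    proof (rule inj_onI)
      fix x y assume "x \<in> T" "y \<in> T" "f x = f y"
      then show "x = y" using d[of x y] False by auto
    qed
    then show ?thesis ..
  qed
qed

lemma collinear_0_cross: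
  fixes z w :: complex
  assumes "collinear {0, z, w}"
  shows "Re z * Im w = Im z * Re w"
  using assms by (auto simp: collinear_lemma)

text \<open>The hypotheses say that the cross product of a + v b and c + v d vanishes identically in
  v; the last one, a complex equation, covers the coefficients of both Re v and Im v. If
  \<open>a\<close> is nonzero, then c = s a with s real, and that equation forces d = s b.\<close>

lemma collinear_pairs:
  fixes a b c d :: complex
  assumes ac: "Im (cnj a * c) = 0" and bd: "Im (cnj b * d) = 0" and eq: "cnj a * d = b * cnj c"
  shows "collinear {0, (a, b), (c, d)}"
proof -
  have real_multiple: "\<exists>s. y = s *\<^sub>R x" if "x \<noteq> 0" "Im (cnj x * y) = 0" for x y :: complex
  proof -
    have "Im (y / x) = 0" using that(2) by (simp add: Im_divide algebra_simps)
    then have "y / x = of_real (Re (y / x))" by (simp add: complex_eq_iff)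
    then have "y = Re (y / x) *\<^sub>R x"
      using that(1) by (metis nonzero_divide_eq_eq scaleR_conv_of_real)
    then show ?thesis by blast
  qed
  consider "a \<noteq> 0" | "a = 0" "b \<noteq> 0" | "a = 0" "b = 0" by blast
  then show ?thesis
  proof cases
    case 1
    then obtain s where c: "c = s *\<^sub>R a" using real_multiple ac by blast
    then have "cnj a * d = cnj a * (s *\<^sub>R b)" using eq by simp
    then have "d = s *\<^sub>R b" using 1 by (metis complex_cnj_zero_iff mult_left_cancel)
    then have "(c, d) = s *\<^sub>R (a, b)" using c by simp
    then show ?thesis unfolding collinear_lemma by blast
  next
    case 2
    then have "c = 0" using eq by simp
    moreover obtain s where "d = s *\<^sub>R b" using real_multiple 2 bd by blast
    ultimately have "(c, d) = s *\<^sub>R (a, b)" using 2 by simp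
    then show ?thesis unfolding collinear_lemma by blast
  next
    case 3
    then show ?thesis by (simp add: zero_prod_def)
  qed
qed

definition curve :: "real \<Rightarrow> complex" where
  "curve t = Complex t (t\<^sup>2)"

text \<open>
  The cross product of two vectors \<open>a + v b\<close> and \<open>c + v d\<close> is a real combination of \<open>1\<close>, \<open>Re v\<close>,
  \<open>Im v\<close> and \<open>\<bar>v\<bar>\<^sup>2\<close>. These are linearly independent along the curve \<open>v = t + i t\<^sup>2\<close>, so that
  the exceptional parameters are the roots of a nonzero polynomial in \<open>t\<close>.
\<close>

lemma finite_collinear_projections_0:
  assumes "\<not> collinear {0, x, y}"
  shows "finite {t. collinear {0, proj (curve t) x, proj (curve t) y}}"
proof -
  obtain a b c d where xy: "x = (a, b)" "y = (c, d)" by fastforce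
  define c0 where "c0 = Im (cnj a * c)"
  define c1 where "c1 = Im (cnj a * d - b * cnj c)"
  define c2 where "c2 = Re (cnj a * d - b * cnj c)"
  define c4 where "c4 = Im (cnj b * d)"
  \<comment> \<open>On the curve, Re v = t, Im v = t^2 and |v|^2 = t^2 + t^4, so \<open>c4\<close>
    enters in degrees 2 and 4 and can be recovered from the top coefficient.\<close>
  define q where "q = [:c0, c1, c2 + c4, 0, c4:]"
  have "q \<noteq> 0"
  proof
    assume "q = 0"
    then have "c0 = 0" "c1 = 0" "c2 = 0" "c4 = 0" by (auto simp: q_def)
    then have "collinear {0, x, y}"
      unfolding xy by (intro collinear_pairs) (auto simp: c0_def c1_def c2_def c4_def complex_eq_iff)
    then show False using assms by simp
  qed
  then have fin: "finite {t. poly q t = 0}" by (rule poly_roots_finite)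
  have root: "poly q t = 0" if "collinear {0, proj (curve t) x, proj (curve t) y}" for t
    using collinear_0_cross[OF that]
    by (simp add: q_def c0_def c1_def c2_def c4_def xy proj_def curve_def algebra_simps power2_eq_square)
  show ?thesis by (rule finite_subset[OF _ fin]) (use root in auto)
qed

lemma finite_collinear_projections:
  assumes "\<not> collinear {x, y, z}"
  shows "finite {t. collinear {proj (curve t) x, proj (curve t) y, proj (curve t) z}}"
proof -
  have c3: "collinear {p, q, r} \<longleftrightarrow> collinear {0, p - q, r - q}" for p q r :: "'a::euclidean_space"
    by (rule collinear_3) (simp add: NO_MATCH_def)
  show ?thesis
    using finite_collinear_projections_0[of "x - y" "z - y"] assms
    by (simp only: c3[of x y z] c3[of "proj _ x"] linear_diff[OF linear_proj] not_False_eq_True simp_thms)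
qed

text \<open>A coincidence determines the number \<open>curve t\<close>, and \<open>t\<close> is its
  real part, so at most one parameter is lost.\<close>

lemma finite_coinciding_projections:
  assumes "x \<noteq> y"
  shows "finite {t. proj (curve t) x = proj (curve t) y}"
proof -
  have "curve t = - (fst x - fst y) / (snd x - snd y)" if "proj (curve t) x = proj (curve t) y" for t
  proof -
    have "snd x \<noteq> snd y" using that assms by (auto simp: proj_def prod_eq_iff)
    then show ?thesis using that by (simp add: proj_def field_simps)
  qed
  then have "{t. proj (curve t) x = proj (curve t) y} \<subseteq> {Re (- (fst x - fst y) / (snd x - snd y))}"
    by (auto simp: curve_def)
  then show ?thesis by (rule finite_subset) simp
qed

text \<open>Two distinct points of \<open>T\<close> fix a line that every third point must lie on.
  For a finite set this leaves only finitely many triples to preserve.\<close>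

lemma collinear_if_triples:
  fixes T :: "'a::euclidean_space set"
  assumes "\<And>x y z. x \<in> T \<Longrightarrow> y \<in> T \<Longrightarrow> z \<in> T \<Longrightarrow> collinear {x, y, z}"
  shows "collinear T"
proof (cases "\<exists>x\<in>T. \<exists>y\<in>T. x \<noteq> y")
  case True
  then obtain x y where xy: "x \<in> T" "y \<in> T" "x \<noteq> y" by blast
  then have "collinear (insert x (insert y T))"
    using collinear_triples[of x y T] assms by blast
  then show ?thesis by (rule collinear_subset) auto
next
  case False
  then have "T = {} \<or> (\<exists>x. T = {x})" by blast
  then show ?thesis by auto
qed

text \<open>Each pair of distinct points and each noncollinear triple of \<open>S\<close> rules out
  finitely many \<open>t\<close>; finitely many exclusions cannot exhaust the reals.\<close>

lemma generic_projection:
  assumes "finite S"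
  shows "\<exists>v. inj_on (proj v) S \<and> (\<forall>T\<subseteq>S. collinear (proj v ` T) \<longrightarrow> collinear T)"
proof -
  define bad where "bad =
    (\<Union>(x, y)\<in>{(x, y) \<in> S \<times> S. x \<noteq> y}. {t. proj (curve t) x = proj (curve t) y}) \<union>
    (\<Union>(x, y, z)\<in>{(x, y, z) \<in> S \<times> S \<times> S. \<not> collinear {x, y, z}}.
       {t. collinear {proj (curve t) x, proj (curve t) y, proj (curve t) z}})"
  have "finite bad"
    unfolding bad_def
  proof (intro finite_UnI finite_UN_I)
    show "finite {(x, y) \<in> S \<times> S. x \<noteq> y}"
      by (rule finite_subset[of _ "S \<times> S"]) (use assms in auto)
    show "finite {(x, y, z) \<in> S \<times> S \<times> S. \<not> collinear {x, y, z}}"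
      by (rule finite_subset[of _ "S \<times> S \<times> S"]) (use assms in auto)
  qed (auto intro: finite_coinciding_projections finite_collinear_projections)
  then obtain t where t: "t \<notin> bad" by (meson ex_new_if_finite infinite_UNIV_char_0)
  show ?thesis
  proof (intro exI[of _ "curve t"] conjI allI impI)
    show "inj_on (proj (curve t)) S"
      using t by (auto simp: bad_def inj_on_def)
    show "collinear T" if T: "T \<subseteq> S" "collinear (proj (curve t) ` T)" for T
    proof (rule collinear_if_triples)
      fix x y z assume xyz: "x \<in> T" "y \<in> T" "z \<in> T"
      then have "collinear {proj (curve t) x, proj (curve t) y, proj (curve t) z}"
        by (intro collinear_subset[OF T(2)]) auto
      moreover have "x \<in> S" "y \<in> S" "z \<in> S" using xyz T(1) by auto
      ultimately show "collinear {x, y, z}" using t unfolding bad_def by blast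
    qed
  qed
qed

lemma generic_projection_no_collinear:
  assumes "finite S" and "\<And>T. T \<subseteq> S \<Longrightarrow> collinear T \<Longrightarrow> card T \<noteq> m"
  shows "\<exists>v. inj_on (proj v) S \<and> no_collinear m (proj v ` S)"
proof -
  obtain v where v: "inj_on (proj v) S"
    "\<forall>T\<subseteq>S. collinear (proj v ` T) \<longrightarrow> collinear T"
    using generic_projection[OF assms(1)] by (elim exE conjE) (rule that)
  have "no_collinear m (proj v ` S)"
    unfolding no_collinear_def
  proof clarify
    fix T assume T: "T \<subseteq> proj v ` S" "collinear T" and m: "m = card T"
    obtain T' where T': "T' \<subseteq> S" "T = proj v ` T'" using T(1) unfolding subset_image_iff by blast
    then have "card T = card T'" using v(1) by (metis card_image inj_on_subset)
    then show False using v(2) assms(2) T T' m by metis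
  qed
  with v(1) show ?thesis by blast
qed

text \<open>A coordinate injective on \<open>T\<close> would carry it to \<open>m\<close> collinear
  points of a factor. Otherwise both coordinates are constant and \<open>T\<close> has at most one
  point.\<close>

lemma card_collinear_Times:
  assumes "no_collinear m A" and "no_collinear m B" and "T \<subseteq> A \<times> B" and "collinear T" and "m \<ge> 2"
  shows "card T \<noteq> m"
proof
  assume m: "card T = m"
  have fst: "linear (fst :: complex \<times> complex \<Rightarrow> complex)"
    and snd: "linear (snd :: complex \<times> complex \<Rightarrow> complex)"
    by (auto intro: bounded_linear.linear bounded_linear_fst bounded_linear_snd)
  have nfst: "\<not> inj_on fst T"
  proof
    assume "inj_on fst T"
    then have "card (fst ` T) = m" using m by (simp add: card_image)
    moreover have "fst ` T \<subseteq> A" using assms(3) by auto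
    ultimately show False
      using assms(1) collinear_linear_image[OF fst assms(4)] unfolding no_collinear_def by blast
  qed
  have nsnd: "\<not> inj_on snd T"
  proof
    assume "inj_on snd T"
    then have "card (snd ` T) = m" using m by (simp add: card_image)
    moreover have "snd ` T \<subseteq> B" using assms(3) by auto
    ultimately show False
      using assms(2) collinear_linear_image[OF snd assms(4)] unfolding no_collinear_def by blast
  qed
  obtain a b where "\<forall>x\<in>T. fst x = a" "\<forall>x\<in>T. snd x = b"
    using linear_inj_or_constant_on_collinear[OF fst assms(4)] linear_inj_or_constant_on_collinear[OF snd assms(4)]
      nfst nsnd by blast
  then have "T \<subseteq> {(a, b)}" by auto
  then have "card T \<le> 1" using card_mono[of "{(a, b)}" T] by simp
  then show False using m assms(5) by simp
qed

section \<open>Counting affine maps\<close>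

definition app :: "complex \<times> complex \<Rightarrow> complex \<Rightarrow> complex" where
  "app f p = fst f * p + snd f"

definition affine_maps :: "complex set \<Rightarrow> complex set \<Rightarrow> (complex \<times> complex) set" where
  "affine_maps P A = {f. \<forall>p\<in>P. app f p \<in> A}"

text \<open>A pair (f, g) is a complex affine map from C to C^2, given by its coordinates. Either
  coordinate may be constant, which is what makes the count for a product factor.\<close>

definition affine_pairs ::
  "complex set \<Rightarrow> (complex \<times> complex) set \<Rightarrow> ((complex \<times> complex) \<times> complex \<times> complex) set" where
  "affine_pairs P S = {(f, g). \<forall>p\<in>P. (app f p, app g p) \<in> S}"

lemma affine_pairs_Times: "affine_pairs P (A \<times> B) = affine_maps P A \<times> affine_maps P B"
  by (auto simp: affine_pairs_def affine_maps_def)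

lemma app_eqI:
  assumes "app f p = app g p" and "app f q = app g q" and "p \<noteq> q"
  shows "f = g"
proof -
  have "(fst f - fst g) * (p - q) = 0" using assms(1,2) unfolding app_def by algebra
  then have "fst f = fst g" using assms(3) by simp
  then show ?thesis using assms(1) by (simp add: app_def prod_eq_iff)
qed

lemma affine_maps_inj:
  assumes "p \<in> P" and "q \<in> P" and "p \<noteq> q"
  shows "inj_on (\<lambda>f. (app f p, app f q)) F"
    and "(\<lambda>f. (app f p, app f q)) ` affine_maps P A \<subseteq> A \<times> A"
proof -
  show "inj_on (\<lambda>f. (app f p, app f q)) F"
  proof (rule inj_onI)
    fix f g assume "(app f p, app f q) = (app g p, app g q)"
    then show "f = g" using app_eqI[of f p g q] assms(3) by simp
  qed
  show "(\<lambda>f. (app f p, app f q)) ` affine_maps P A \<subseteq> A \<times> A"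
    using assms by (auto simp: affine_maps_def)
qed

lemma two_points:
  assumes "card P \<ge> 2"
  obtains p q where "p \<in> P" "q \<in> P" "p \<noteq> q"
proof -
  obtain S where "S \<subseteq> P" "card S = 2" using obtain_subset_with_card_n[OF assms] by blast
  then show ?thesis using that by (auto simp: card_2_iff)
qed

lemma finite_affine_maps:
  assumes "card P \<ge> 2" and "finite A"
  shows "finite (affine_maps P A)"
proof -
  obtain p q where pq: "p \<in> P" "q \<in> P" "p \<noteq> q" using two_points[OF assms(1)] .
  show ?thesis
    by (rule inj_on_finite[OF affine_maps_inj[OF pq]]) (simp add: assms(2))
qed

text \<open>As \<open>proj v\<close> is complex linear, composing with it yields an affine map
  again, with slopes and constant terms projected separately (\<open>h\<close>). No two maps merge:
  injectivity on \<open>S\<close> recovers both coordinates at each point of \<open>P\<close>, and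
  two points determine an affine map.\<close>

lemma card_affine_pairs_le:
  assumes P: "card P \<ge> 2" and "finite S" and inj: "inj_on (proj v) S"
  shows "card (affine_pairs P S) \<le> card (affine_maps P (proj v ` S))"
proof -
  obtain p q where pq: "p \<in> P" "q \<in> P" "p \<noteq> q" using two_points[OF P] .
  define h where "h = (\<lambda>(f, g). (proj v (fst f, fst g), proj v (snd f, snd g)))"
  have app_h: "app (h (f, g)) r = proj v (app f r, app g r)" for f g r
    by (simp add: h_def app_def proj_def algebra_simps)
  have "inj_on h (affine_pairs P S)"
  proof (rule inj_onI, clarify)
    fix f g f' g'
    assume *: "(f, g) \<in> affine_pairs P S" "(f', g') \<in> affine_pairs P S" "h (f, g) = h (f', g')"
    have "app f r = app f' r \<and> app g r = app g' r" if "r \<in> P" for r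
    proof -
      have "proj v (app f r, app g r) = proj v (app f' r, app g' r)"
        using *(3) app_h by metis
      then show ?thesis using inj_onD[OF inj] *(1,2) that unfolding affine_pairs_def by blast
    qed
    then show "f = f' \<and> g = g'" using app_eqI[of f p f' q] app_eqI[of g p g' q] pq by blast
  qed
  moreover have "h ` affine_pairs P S \<subseteq> affine_maps P (proj v ` S)"
    unfolding affine_maps_def affine_pairs_def using app_h by fastforce
  ultimately show ?thesis
    by (rule card_inj_on_le) (simp add: finite_affine_maps[OF P] assms(2))
qed

lemma product_set:
  assumes "card P \<ge> 2" and "finite A" "no_collinear m A" and "finite B" "no_collinear m B" and "m \<ge> 2"
  obtains C where "finite C" "card C = card A * card B" "no_collinear m C"
    "card (affine_maps P A) * card (affine_maps P B) \<le> card (affine_maps P C)"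
proof -
  have fin: "finite (A \<times> B)" using assms by simp
  have "\<exists>v. inj_on (proj v) (A \<times> B) \<and> no_collinear m (proj v ` (A \<times> B))"
    by (rule generic_projection_no_collinear[OF fin card_collinear_Times[OF assms(3,5) _ _ assms(6)]])
  then obtain v where v: "inj_on (proj v) (A \<times> B)" "no_collinear m (proj v ` (A \<times> B))"
    by (elim exE conjE) (rule that)
  have "card (affine_maps P A) * card (affine_maps P B) = card (affine_pairs P (A \<times> B))"
    by (simp add: affine_pairs_Times card_cartesian_product)
  also have "\<dots> \<le> card (affine_maps P (proj v ` (A \<times> B)))"
    using card_affine_pairs_le[OF assms(1) fin v(1)] .
  finally show ?thesis
    using that[of "proj v ` (A \<times> B)"] v fin by (simp add: card_image card_cartesian_product)
qed

section \<open>Enlarging a set to a prescribed cardinality\<close>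

text \<open>Place \<open>Q\<close> at height 0 in C^2 and one extra point (0, 1) at height 1. A
  generic projection leaves \<open>Q\<close> where it is and sends the extra point to
  \<open>v\<close>, which is the new point.\<close>

lemma no_collinear_extend:
  assumes "finite Q" and "no_collinear m Q" and "m \<ge> 3"
  shows "\<exists>x. x \<notin> Q \<and> no_collinear m (insert x Q)"
proof -
  define S where "S = insert (0, 1) (Q \<times> {0 :: complex})"
  have fin: "finite S" using assms(1) by (simp add: S_def)
  have "card T \<noteq> m" if T: "T \<subseteq> S" "collinear T" for T
  proof -
    have snd: "linear (snd :: complex \<times> complex \<Rightarrow> complex)"
      by (auto intro: bounded_linear.linear bounded_linear_snd)
    consider "inj_on snd T" | c where "\<forall>x\<in>T. snd x = c"
      using linear_inj_or_constant_on_collinear[OF snd T(2)] by blast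
    then show ?thesis
    proof cases
      case 1
      \<comment> \<open>A collinear set that is not level meets each of the two heights at most
        once, so it has at most two points; this is where m >= 3 enters.\<close>
      have "snd ` T \<subseteq> {0, 1}" using T(1) by (auto simp: S_def)
      then have "card (snd ` T) \<le> card {0, 1 :: complex}" by (intro card_mono) auto
      then show ?thesis using 1 assms(3) by (simp add: card_image)
    next
      case 2
      show ?thesis
      proof (cases "c = 0")
        case True
        then have "T \<subseteq> Q \<times> {0}" using T(1) 2 by (force simp: S_def)
        moreover have "no_collinear m {0}"
          using assms(3) by (auto simp: no_collinear_def subset_singleton_iff)
        ultimately show ?thesis using card_collinear_Times assms(2,3) T(2) by auto
      next
        case False
        then have "T \<subseteq> {(0, 1)}" using T(1) 2 by (force simp: S_def)
        then have "card T \<le> card {(0 :: complex, 1 :: complex)}" by (intro card_mono) auto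
        then show ?thesis using assms(3) by simp
      qed
    qed
  qed
  then have "\<exists>v. inj_on (proj v) S \<and> no_collinear m (proj v ` S)"
    by (rule generic_projection_no_collinear[OF fin])
  then obtain v where v: "inj_on (proj v) S" "no_collinear m (proj v ` S)"
    by (elim exE conjE) (rule that)
  have "proj v ` S = insert v Q" by (force simp: S_def proj_def)
  moreover have "v \<notin> Q"
  proof
    assume "v \<in> Q"
    then have "proj v (v, 0) = proj v (0, 1)" "(v, 0) \<in> S" "(0, 1) \<in> S" by (auto simp: S_def proj_def)
    then show False using v(1) by (metis inj_onD prod.inject zero_neq_one)
  qed
  ultimately show ?thesis using v(2) by auto
qed

lemma no_collinear_extend_card:
  assumes "finite Q" and "no_collinear m Q" and "m \<ge> 3" and "card Q \<le> n"
  shows "\<exists>R. finite R \<and> card R = n \<and> no_collinear m R \<and> Q \<subseteq> R"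
  using assms(4)
proof (induction n rule: dec_induct)
  case base
  then show ?case using assms by blast
next
  case (step n)
  then obtain R where R: "finite R" "card R = n" "no_collinear m R" "Q \<subseteq> R" by blast
  then obtain x where "x \<notin> R" "no_collinear m (insert x R)" using no_collinear_extend assms(3) by blast
  then show ?case using R by (intro exI[of _ "insert x R"]) auto
qed

section \<open>The base set and its powers\<close>

text \<open>The formula is affine in \<open>x\<close> for fixed \<open>y\<close> and in
  \<open>y\<close> for fixed \<open>x\<close>, so the grid carries images of \<open>P\<close> in
  both directions. All pairs with x = p collapse to the origin, which saves k - 1 of the k^2
  points.\<close>

definition base_pairs :: "complex \<Rightarrow> complex set \<Rightarrow> (complex \<times> complex) set" where
  "base_pairs p P = (\<lambda>(x, y). ((x - p) * y, x - p)) ` (P \<times> P)"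

lemma base_pairs_eq:
  assumes "p \<in> P"
  shows "base_pairs p P = insert (0, 0) ((\<lambda>(x, y). ((x - p) * y, x - p)) ` ((P - {p}) \<times> P))"
  using assms by (force simp: base_pairs_def image_iff)

lemma card_base_pairs:
  assumes "finite P" and "p \<in> P"
  shows "card (base_pairs p P) = (card P - 1) * card P + 1"
proof -
  have "inj_on (\<lambda>(x, y). ((x - p) * y, x - p)) ((P - {p}) \<times> P)" by (auto simp: inj_on_def)
  then have "card ((\<lambda>(x, y). ((x - p) * y, x - p)) ` ((P - {p}) \<times> P)) = (card P - 1) * card P"
    using assms by (simp add: card_image card_cartesian_product)
  moreover have "(0, 0) \<notin> (\<lambda>(x, y). ((x - p) * y, x - p)) ` ((P - {p}) \<times> P)" by auto
  ultimately show ?thesis using assms by (simp add: base_pairs_eq)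
qed

text \<open>If the heights are distinct, translating them by \<open>p\<close> embeds
  \<open>T\<close> in \<open>P\<close>. If they share a value \<open>a\<close> other than 0, the
  first coordinates divided by \<open>a\<close> do so. At height 0 there is only the origin.\<close>

lemma card_collinear_base_pairs:
  assumes "no_collinear m P" and "T \<subseteq> base_pairs p P" and "collinear T" and "m \<ge> 2"
  shows "card T \<noteq> m"
proof
  assume m: "card T = m"
  have fst: "linear (fst :: complex \<times> complex \<Rightarrow> complex)"
    and snd: "linear (snd :: complex \<times> complex \<Rightarrow> complex)"
    by (auto intro: bounded_linear.linear bounded_linear_fst bounded_linear_snd)
  have P: "card U \<noteq> m" if "U \<subseteq> P" "collinear U" for U
    using assms(1) that unfolding no_collinear_def by blast
  consider "inj_on snd T" | a where "\<forall>x\<in>T. snd x = a"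
    using linear_inj_or_constant_on_collinear[OF snd assms(3)] by blast
  then show False
  proof cases
    case 1
    have "collinear ((\<lambda>z. p + z) ` (snd ` T))"
      using collinear_linear_image[OF snd assms(3)] by (force simp: collinear_def)
    moreover have "(\<lambda>z. p + z) ` (snd ` T) \<subseteq> P" using assms(2) by (auto simp: base_pairs_def)
    ultimately show False using P m 1 by (metis card_image inj_on_add)
  next
    case 2
    show False
    proof (cases "a = 0")
      case True
      then have "T \<subseteq> {(0, 0)}" using assms(2) 2 by (force simp: base_pairs_def)
      then have "card T \<le> card {(0 :: complex, 0 :: complex)}" by (intro card_mono) auto
      then show False using m assms(4) by simp
    next
      case False
      have "linear (\<lambda>z :: complex \<times> complex. fst z / a)"
        by (rule linearI) (auto simp: add_divide_distrib scaleR_conv_of_real)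
      then have "collinear ((\<lambda>z. fst z / a) ` T)" using collinear_linear_image assms(3) by blast
      moreover have "(\<lambda>z. fst z / a) ` T \<subseteq> P" using assms(2) 2 False by (force simp: base_pairs_def)
      moreover have "inj_on (\<lambda>z. fst z / a) T" using 2 False by (auto simp: inj_on_def prod_eq_iff)
      ultimately show False using P m by (metis card_image)
    qed
  qed
qed

lemma card_affine_pairs_base:
  assumes "finite P" and "card P \<ge> 2" and "p \<in> P" and "finite (affine_pairs P (base_pairs p P))"
  shows "card P ^ 2 + card P \<le> card (affine_pairs P (base_pairs p P))"
proof -
  let ?S = "base_pairs p P"
  \<comment> \<open>The families are the constants, the maps with x fixed and the maps with y fixed.
    \<open>F2\<close> omits x = p because that map is constant and already lies in
    \<open>F1\<close>.\<close>
  define F1 where "F1 = (\<lambda>(a, b). ((0 :: complex, a :: complex), (0 :: complex, b :: complex))) ` ?S"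
  define F2 where "F2 = (\<lambda>x. ((x - p, 0 :: complex), (0 :: complex, x - p))) ` (P - {p})"
  define F3 where "F3 = (\<lambda>y. ((y, - p * y), (1 :: complex, - p))) ` P"
  have fin: "finite F1" "finite F2" "finite F3"
    using assms(1) by (auto simp: F1_def F2_def F3_def base_pairs_def)
  have "card F1 = (card P - 1) * card P + 1"
    unfolding F1_def using card_base_pairs[OF assms(1,3)] by (subst card_image) (auto simp: inj_on_def)
  moreover have "card F2 = card P - 1"
    unfolding F2_def using assms(1,3) by (subst card_image) (auto simp: inj_on_def)
  moreover have "card F3 = card P"
    unfolding F3_def by (subst card_image) (auto simp: inj_on_def)
  \<comment> \<open>Slopes separate the families: (0, 0) in \<open>F1\<close>, (x - p, 0) with x - p
    nonzero in \<open>F2\<close>, and second slope 1 in \<open>F3\<close>.\<close>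
  moreover have "F1 \<inter> F2 = {}" "(F1 \<union> F2) \<inter> F3 = {}"
    by (auto simp: F1_def F2_def F3_def)
  ultimately have "card (F1 \<union> F2 \<union> F3) = (card P - 1) * card P + 1 + (card P - 1) + card P"
    using fin by (simp add: card_Un_disjoint)
  also have "\<dots> = card P ^ 2 + card P"
    using assms(2) by (cases "card P") (auto simp: power2_eq_square)
  finally have card: "card (F1 \<union> F2 \<union> F3) = card P ^ 2 + card P" .
  have "F1 \<subseteq> affine_pairs P ?S"
    by (auto simp: F1_def affine_pairs_def app_def)
  moreover have "F2 \<subseteq> affine_pairs P ?S"
    by (auto simp: F2_def affine_pairs_def app_def base_pairs_def)
  moreover have "F3 \<subseteq> affine_pairs P ?S"
    by (force simp: F3_def affine_pairs_def app_def base_pairs_def algebra_simps)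
  ultimately have "F1 \<union> F2 \<union> F3 \<subseteq> affine_pairs P ?S" by simp
  then show ?thesis using card card_mono[OF assms(4)] by metis
qed

text \<open>Enclosing \<open>S\<close> in the product of its coordinate projections reduces this to
  the planar case.\<close>

lemma finite_affine_pairs:
  assumes "card P \<ge> 2" and "finite S"
  shows "finite (affine_pairs P S)"
proof -
  have "affine_pairs P S \<subseteq> affine_pairs P (fst ` S \<times> snd ` S)"
    by (force simp: affine_pairs_def)
  also have "\<dots> = affine_maps P (fst ` S) \<times> affine_maps P (snd ` S)"
    by (rule affine_pairs_Times)
  finally show ?thesis by (rule finite_subset) (simp add: finite_affine_maps assms)
qed

lemma base_set:
  assumes "finite P" and "card P \<ge> 2" and "no_collinear m P" and "m \<ge> 2"
  obtains A where "finite A" "card A = (card P - 1) * card P + 1" "no_collinear m A"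
    "card P ^ 2 + card P \<le> card (affine_maps P A)"
proof -
  obtain p where p: "p \<in> P" using two_points[OF assms(2)] by blast
  have fin: "finite (base_pairs p P)" using assms(1) by (simp add: base_pairs_def)
  have "\<exists>v. inj_on (proj v) (base_pairs p P) \<and> no_collinear m (proj v ` base_pairs p P)"
    by (rule generic_projection_no_collinear[OF fin card_collinear_base_pairs[OF assms(3) _ _ assms(4)]])
  then obtain v where v: "inj_on (proj v) (base_pairs p P)" "no_collinear m (proj v ` base_pairs p P)"
    by (elim exE conjE) (rule that)
  have "card P ^ 2 + card P \<le> card (affine_pairs P (base_pairs p P))"
    using card_affine_pairs_base[OF assms(1,2) p] finite_affine_pairs[OF assms(2) fin] by blast
  also have "\<dots> \<le> card (affine_maps P (proj v ` base_pairs p P))"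
    using card_affine_pairs_le[OF assms(2) fin v(1)] .
  finally show ?thesis
    using that[of "proj v ` base_pairs p P"] v fin card_base_pairs[OF assms(1) p] by (simp add: card_image)
qed

text \<open>Each induction step takes the product with one more base set. Writing the exponent as
  \<open>Suc j\<close> lets the induction start at the base set itself.\<close>

lemma power_set:
  assumes P: "finite P" "card P \<ge> 2" and m: "no_collinear m P" "m \<ge> 2"
  shows "\<exists>A. finite A \<and> card A = ((card P - 1) * card P + 1) ^ Suc j \<and> no_collinear m A \<and>
    (card P ^ 2 + card P) ^ Suc j \<le> card (affine_maps P A)"
proof (induction j)
  case 0
  show ?case using base_set[OF assms] by (metis power_one_right One_nat_def)
next
  case (Suc j)
  then obtain A where A: "finite A" "card A = ((card P - 1) * card P + 1) ^ Suc j" "no_collinear m A"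
    "(card P ^ 2 + card P) ^ Suc j \<le> card (affine_maps P A)" by blast
  obtain B where B: "finite B" "card B = (card P - 1) * card P + 1" "no_collinear m B"
    "card P ^ 2 + card P \<le> card (affine_maps P B)" using base_set[OF assms] .
  obtain C where C: "finite C" "card C = card B * card A" "no_collinear m C"
    "card (affine_maps P B) * card (affine_maps P A) \<le> card (affine_maps P C)"
    using product_set[OF P(2) B(1,3) A(1,3) m(2)] .
  have "(card P ^ 2 + card P) ^ Suc (Suc j) \<le> card (affine_maps P B) * card (affine_maps P A)"
    unfolding power_Suc[of _ "Suc j"] using B(4) A(4) by (rule mult_le_mono)
  also have "\<dots> \<le> card (affine_maps P C)" by (rule C(4))
  finally have "(card P ^ 2 + card P) ^ Suc (Suc j) \<le> card (affine_maps P C)" .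
  then show ?case using C(1-3) A(2) B(2) by (intro exI[of _ C]) simp
qed

section \<open>From affine maps to similar copies\<close>

text \<open>There are at most \<open>card A\<close> constant maps. A nonconstant one is determined
  by its image, which is a similar copy, and by the positions of two points of \<open>P\<close> in
  it, so each copy accounts for at most k^2 maps.\<close>

lemma card_affine_maps_le_copies:
  assumes "finite P" and "card P \<ge> 2" and "finite A"
  shows "card (affine_maps P A) \<le> card A + card P ^ 2 * similar_copies P A"
proof -
  obtain p q where pq: "p \<in> P" "q \<in> P" "p \<noteq> q" using two_points[OF assms(2)] .
  define N where "N = {f \<in> affine_maps P A. fst f \<noteq> 0}"
  define X where "X = {B. B \<subseteq> A \<and> similar P B}"
  have "finite X" unfolding X_def using assms(3) by simp
  have card_X: "card B = card P" if "B \<in> X" for B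
  proof -
    obtain z w where zw: "z \<noteq> 0" "B = (\<lambda>x. z * x + w) ` P"
      using \<open>B \<in> X\<close> unfolding X_def similar_def by blast
    then have "inj_on (\<lambda>x. z * x + w) P" by (auto simp: inj_on_def)
    then show ?thesis using zw(2) card_image by blast
  qed
  have fin_X: "finite B" if "B \<in> X" for B
    using that assms(3) by (auto simp: X_def intro: finite_subset)
  have "affine_maps P A \<subseteq> Pair 0 ` A \<union> N"
    using pq by (force simp: affine_maps_def N_def app_def)
  then have "card (affine_maps P A) \<le> card (Pair (0 :: complex) ` A \<union> N)"
    by (rule card_mono[rotated]) (use finite_affine_maps assms in \<open>auto simp: N_def\<close>)
  also have "\<dots> \<le> card A + card N"
    using card_Un_le[of "Pair (0 :: complex) ` A" N] card_image_le[OF assms(3), of "Pair (0 :: complex)"]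
    by linarith
  also have "card N \<le> card (SIGMA B:X. B \<times> B)"
  proof (rule card_inj_on_le)
    show "inj_on (\<lambda>f. (app f ` P, app f p, app f q)) N"
      using affine_maps_inj(1)[OF pq, of N] by (auto simp: inj_on_def)
    have "app f ` P \<in> X" if "f \<in> N" for f
      using that unfolding X_def N_def affine_maps_def similar_def app_def by blast
    then show "(\<lambda>f. (app f ` P, app f p, app f q)) ` N \<subseteq> (SIGMA B:X. B \<times> B)"
      using pq by auto
    show "finite (SIGMA B:X. B \<times> B)" using \<open>finite X\<close> fin_X by auto
  qed
  also have "card (SIGMA B:X. B \<times> B) = card P ^ 2 * similar_copies P A"
    using \<open>finite X\<close> fin_X card_X
    by (simp add: card_SigmaI card_cartesian_product power2_eq_square similar_copies_def X_def)
  finally show ?thesis by simp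
qed

lemma similar_copies_mono:
  assumes "A \<subseteq> B" and "finite B"
  shows "similar_copies P A \<le> similar_copies P B"
  unfolding similar_copies_def by (rule card_mono) (use assms in auto)

lemma max_similar_copies_ge:
  assumes P: "finite P" "card P = k" "k \<ge> 3" and m: "no_collinear m P" "m \<ge> 3"
    and n: "((k - 1) * k + 1) ^ Suc j \<le> n"
  shows "(k ^ 2 + k) ^ Suc j \<le> ((k - 1) * k + 1) ^ Suc j + k ^ 2 * max_similar_copies P n m"
proof -
  have P2: "card P \<ge> 2" and m2: "m \<ge> 2" using P m by auto
  obtain A where A: "finite A" "card A = ((k - 1) * k + 1) ^ Suc j" "no_collinear m A"
    "(k ^ 2 + k) ^ Suc j \<le> card (affine_maps P A)"
    using power_set[OF P(1) P2 m(1) m2] unfolding P(2) by blast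
  then obtain R where R: "finite R" "card R = n" "no_collinear m R" "A \<subseteq> R"
    using no_collinear_extend_card m(2) n by metis
  have "similar_copies P A \<le> similar_copies P R" using similar_copies_mono R by blast
  also have "\<dots> \<le> max_similar_copies P n m"
    unfolding max_similar_copies_def using R by (intro Max_ge finite_similar_copies_values) blast
  finally have "k ^ 2 * similar_copies P A \<le> k ^ 2 * max_similar_copies P n m" by simp
  moreover have "card (affine_maps P A) \<le> card A + k ^ 2 * similar_copies P A"
    using card_affine_maps_le_copies[OF P(1) P2 A(1)] P(2) by simp
  ultimately show ?thesis using A by linarith
qed

section \<open>From powers of the base set to all large n\<close>

text \<open>The constant is chosen before \<open>m\<close> and depends only on
  \<open>k\<close>.\<close>

theorem theorem2:
  fixes P :: "complex set" and k :: nat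
  assumes "finite P" and "card P = k" and "k \<ge> 3"
  shows "\<exists>c::real. c > 0 \<and>
    (\<forall>m\<ge>3. no_collinear m P \<longrightarrow>
      (\<forall>\<^sub>F n in sequentially.
        real (max_similar_copies P n m) \<ge>
          c * real n powr (ln ((real k)\<^sup>2 + real k) / ln ((real k)\<^sup>2 - real k + 1))))"
proof -
  define N where "N = (k - 1) * k + 1"
  define K where "K = k ^ 2 + k"
  define \<alpha> where "\<alpha> = ln (real K) / ln (real N)"
  \<comment> \<open>The numerator is what remains after discarding the constant maps, k^2 is the
    overcount of each copy, and the factor \<open>K\<close> pays for rounding n up to the next power
    of \<open>N\<close>, since N^\<alpha> = K.\<close>
  define c where "c = (1 - real N / real K) / (real k ^ 2 * real K)"
  have rN: "real N = (real k)\<^sup>2 - real k + 1"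
    using assms(3) by (simp add: N_def of_nat_diff power2_eq_square algebra_simps)
  have rK: "real K = (real k)\<^sup>2 + real k" by (simp add: K_def)
  have "real N < real K" unfolding rN rK using assms(3) by simp
  then have NK: "N < K" by simp
  have "(k - 1) * k > 0" using assms(3) by simp
  then have N1: "N > 1" unfolding N_def by linarith
  have K0: "real K > 0" using NK by simp
  have "c > 0" using NK assms(3) by (simp add: c_def)
  have N_powr: "real N powr \<alpha> = real K"
    using N1 K0 by (simp add: powr_def \<alpha>_def)
  \<comment> \<open>The threshold for n is \<open>N\<close> itself, whatever \<open>m\<close>
    is.\<close>
  have bound: "c * real n powr \<alpha> \<le> real (max_similar_copies P n m)"
    if m: "m \<ge> 3" "no_collinear m P" and n: "n \<ge> N" for m n
  proof -
    obtain i where i: "N ^ i \<le> n" "n < N ^ Suc i"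
      using ex_power_ivl1[of N n] N1 n by auto
    \<comment> \<open>Besides giving the form \<open>Suc j\<close>, this is essential for absorbing
      the constant maps below: at i = 0 the inequality N^i \<le> (N/K) K^i would fail.\<close>
    have "i \<noteq> 0" using i(2) n by (cases i) auto
    then obtain j where j: "i = Suc j" using not0_implies_Suc by blast
    have "real K ^ i \<le> real N ^ i + real k ^ 2 * real (max_similar_copies P n m)"
    proof -
      have "K ^ i \<le> N ^ i + k ^ 2 * max_similar_copies P n m"
        using max_similar_copies_ge[OF assms m(2,1)] i(1) unfolding N_def K_def j by blast
      then show ?thesis by (metis of_nat_add of_nat_le_iff of_nat_mult of_nat_power)
    qed
    \<comment> \<open>The constant maps take at most the fraction N/K < 1 of the total, because the
      remaining \<open>j\<close> factors N/K are at most 1.\<close>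
    moreover have "real N ^ i \<le> real N / real K * real K ^ i"
    proof -
      have "real N ^ j \<le> real K ^ j" using NK by (intro power_mono) auto
      then have "real N * real N ^ j \<le> real N * real K ^ j" by (rule mult_left_mono) simp
      then show ?thesis using K0 by (simp add: j)
    qed
    ultimately have *: "(1 - real N / real K) * real K ^ i \<le> real k ^ 2 * real (max_similar_copies P n m)"
      by (simp add: algebra_simps)
    have "real n powr \<alpha> \<le> (real N ^ Suc i) powr \<alpha>"
    proof (rule powr_mono2)
      show "0 \<le> \<alpha>" using NK N1 by (simp add: \<alpha>_def)
      show "real n \<le> real N ^ Suc i" using i(2) by (metis less_imp_le of_nat_le_iff of_nat_power)
    qed simp
    also have "\<dots> = (real N powr \<alpha>) ^ Suc i"
      using N1 by (simp add: powr_realpow[symmetric] powr_powr mult.commute powr_mult powr_add)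
    also have "\<dots> = real K * real K ^ i" by (simp add: N_powr)
    finally have "c * real n powr \<alpha> \<le> c * (real K * real K ^ i)"
      using \<open>c > 0\<close> by (intro mult_left_mono) auto
    also have "\<dots> = (1 - real N / real K) * real K ^ i / real k ^ 2"
      using K0 by (simp add: c_def)
    also have "\<dots> \<le> real (max_similar_copies P n m)"
      using * assms(3) by (simp add: pos_divide_le_eq mult.commute)
    finally show ?thesis .
  qed
  show ?thesis
    using \<open>c > 0\<close> bound unfolding \<alpha>_def rN rK eventually_sequentially by blast
qed

end
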